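(* Let $R$ be a commutative ring with Jacobson radical $\mathfrak{J}$ and let $X=\operatorname{Max}(R)$ with the Zariski topology. Then the map $\phi:\mathcal{B}(R/\mathfrak{J})\rightarrow\operatorname{Clop}(X)$ given by $f+\mathfrak{J}\mapsto X\cap D(f)$ is an isomorphism of rings.
   Context: All rings are commutative with $1$. For a ring $A$, $\mathcal{B}(A)=\{e\in A: e=e^{2}\}$ is the Boolean ring of $A$, with addition $e\oplus e'=e+e'-2ee'$ and multiplication $ee'$. $\operatorname{Max}(R)$ is the set of maximal ideals of $R$ with the subspace topology from $\operatorname{Spec}(R)$. For $f\in R$, $D(f)=\{\mathfrak{p}\in\operatorname{Spec}(R): f\notin\mathfrak{p}\}$. For a topological space $X$, $\operatorname{Clop}(X)$ is the set of clopen (both open and closed) subsets of $X$, viewed as a subring of the power set ring $\mathcal{P}(X)$ (addition is symmetric difference, multiplication is intersection, unit is $X$). *)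

theory Defs
  imports "HOL-Algebra.QuotRing" "HOL-Algebra.Subrings" "HOL-Analysis.Abstract_Topology"
begin

definition Spec :: "('a, 'b) ring_scheme \<Rightarrow> 'a set set"
  where "Spec R = {p. primeideal p R}"

definition Maxspec :: "('a, 'b) ring_scheme \<Rightarrow> 'a set set"
  where "Maxspec R = {m. maximalideal m R}"

definition basic_open :: "('a, 'b) ring_scheme \<Rightarrow> 'a \<Rightarrow> 'a set set"
  where "basic_open R f = {p \<in> Spec R. f \<notin> p}"

text \<open>The closed sets are the sets \<open>V(E) = {p. E \<subseteq> p}\<close> for arbitrary subsets \<open>E\<close> of the ring.\<close>

definition zariski :: "('a, 'b) ring_scheme \<Rightarrow> 'a set topology"
  where "zariski R = topology (\<lambda>U. \<exists>E\<subseteq>carrier R. U = Spec R - {p \<in> Spec R. E \<subseteq> p})"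

definition Max_top :: "('a, 'b) ring_scheme \<Rightarrow> 'a set topology"
  where "Max_top R = subtopology (zariski R) (Maxspec R)"

text \<open>Intersecting with the carrier matters only for the zero ring, which has no maximal
  ideals and is its own Jacobson radical.\<close>

definition jacobson_radical :: "('a, 'b) ring_scheme \<Rightarrow> 'a set"
  where "jacobson_radical R = carrier R \<inter> \<Inter>(Maxspec R)"

lemma istopology_zariski:
  "istopology (\<lambda>U. \<exists>E\<subseteq>carrier R. U = Spec R - {p \<in> Spec R. E \<subseteq> p})"
  unfolding istopology_def
proof (intro conjI allI impI)
  fix S T
  assume "\<exists>E\<subseteq>carrier R. S = Spec R - {p \<in> Spec R. E \<subseteq> p}"
    and "\<exists>E\<subseteq>carrier R. T = Spec R - {p \<in> Spec R. E \<subseteq> p}"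
  then obtain E F where E: "E \<subseteq> carrier R" "S = Spec R - {p \<in> Spec R. E \<subseteq> p}"
    and F: "F \<subseteq> carrier R" "T = Spec R - {p \<in> Spec R. F \<subseteq> p}" by blast
  let ?G = "{g \<in> carrier R. \<exists>e\<in>E. \<exists>f\<in>F. g = e \<otimes>\<^bsub>R\<^esub> f}"
  have "E \<subseteq> p \<or> F \<subseteq> p \<longleftrightarrow> ?G \<subseteq> p" if "p \<in> Spec R" for p
  proof -
    interpret primeideal p R using that by (simp add: Spec_def)
    show ?thesis
    proof
      assume "E \<subseteq> p \<or> F \<subseteq> p"
      then show "?G \<subseteq> p"
        using E(1) F(1) I_l_closed I_r_closed by blast
    next
      assume G: "?G \<subseteq> p"
      show "E \<subseteq> p \<or> F \<subseteq> p"
      proof (rule ccontr)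
        assume "\<not> (E \<subseteq> p \<or> F \<subseteq> p)"
        then obtain e f where ef: "e \<in> E" "e \<notin> p" "f \<in> F" "f \<notin> p" by blast
        then have "e \<otimes>\<^bsub>R\<^esub> f \<in> p"
          using G E(1) F(1) m_closed by blast
        then show False
          using I_prime ef E(1) F(1) by blast
      qed
    qed
  qed
  then have "S \<inter> T = Spec R - {p \<in> Spec R. ?G \<subseteq> p}" unfolding E F by blast
  then show "\<exists>E\<subseteq>carrier R. S \<inter> T = Spec R - {p \<in> Spec R. E \<subseteq> p}"
    by (intro exI[of _ ?G]) blast
next
  fix K assume "\<forall>U\<in>K. \<exists>E\<subseteq>carrier R. U = Spec R - {p \<in> Spec R. E \<subseteq> p}"
  from bchoice[OF this] obtain E where E: "\<And>U. U \<in> K \<Longrightarrow> E U \<subseteq> carrier R"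
    and U: "\<And>U. U \<in> K \<Longrightarrow> U = Spec R - {p \<in> Spec R. E U \<subseteq> p}" by blast
  have "(\<Union>U\<in>K. U) = (\<Union>U\<in>K. Spec R - {p \<in> Spec R. E U \<subseteq> p})"
    by (rule SUP_cong[OF refl U])
  also have "\<dots> = Spec R - {p \<in> Spec R. (\<Union>U\<in>K. E U) \<subseteq> p}" by blast
  finally have "\<Union>K = Spec R - {p \<in> Spec R. (\<Union>U\<in>K. E U) \<subseteq> p}" by simp
  moreover have "(\<Union>U\<in>K. E U) \<subseteq> carrier R" using E by blast
  ultimately show "\<exists>E\<subseteq>carrier R. \<Union>K = Spec R - {p \<in> Spec R. E \<subseteq> p}" by blast
qed

lemma openin_zariski:
  "openin (zariski R) U \<longleftrightarrow> (\<exists>E\<subseteq>carrier R. U = Spec R - {p \<in> Spec R. E \<subseteq> p})"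
  unfolding zariski_def by (simp add: topology_inverse'[OF istopology_zariski])

lemma openin_basic_open: "f \<in> carrier R \<Longrightarrow> openin (zariski R) (basic_open R f)"
  unfolding openin_zariski basic_open_def by (intro exI[of _ "{f}"]) auto

lemma topspace_zariski:
  assumes "cring R" shows "topspace (zariski R) = Spec R"
proof
  show "topspace (zariski R) \<subseteq> Spec R"
    unfolding topspace_def openin_zariski by blast
  have "\<one>\<^bsub>R\<^esub> \<in> carrier R"
    using assms by (simp add: cring.axioms(1) ring.ring_simprules(6))
  moreover have "basic_open R \<one>\<^bsub>R\<^esub> = Spec R"
    unfolding basic_open_def Spec_def
    using ideal.one_imp_carrier primeideal.I_notcarr primeideal.axioms(1) by fastforce
  ultimately show "Spec R \<subseteq> topspace (zariski R)"
    using openin_basic_open openin_subset by metis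
qed

lemma topspace_Max_top:
  assumes "cring R" shows "topspace (Max_top R) = Maxspec R"
  using cring.maximalideal_prime[OF assms]
  by (auto simp: Max_top_def topspace_zariski[OF assms] Maxspec_def Spec_def)

lemma ideal_jacobson_radical:
  assumes "cring R" shows "ideal (jacobson_radical R) R"
proof -
  interpret cring R by (rule assms)
  have "jacobson_radical R = \<Inter>(insert (carrier R) (Maxspec R))"
    by (simp add: jacobson_radical_def)
  moreover have "ideal I R" if "I \<in> insert (carrier R) (Maxspec R)" for I
    using that oneideal by (auto simp: Maxspec_def maximalideal.axioms(1))
  ultimately show ?thesis
    using i_Intersect[of "insert (carrier R) (Maxspec R)"] by simp
qed

definition idem_ring :: "('a, 'b) ring_scheme \<Rightarrow> 'a ring"
  where "idem_ring A =
    \<lparr>carrier = {e \<in> carrier A. e = e [^]\<^bsub>A\<^esub> (2::nat)},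
     monoid.mult = (\<otimes>\<^bsub>A\<^esub>), monoid.one = \<one>\<^bsub>A\<^esub>, ring.zero = \<zero>\<^bsub>A\<^esub>,
     ring.add = (\<lambda>e e'. (e \<oplus>\<^bsub>A\<^esub> e') \<ominus>\<^bsub>A\<^esub> [(2::nat)] \<cdot>\<^bsub>A\<^esub> (e \<otimes>\<^bsub>A\<^esub> e'))\<rparr>"

lemma cring_idem_ring:
  assumes "cring A" shows "cring (idem_ring A)"
proof -
  interpret cring A by (rule assms)
  have pow2: "e [^]\<^bsub>A\<^esub> (2::nat) = e \<otimes>\<^bsub>A\<^esub> e" if "e \<in> carrier A" for e
    using that by (simp add: numeral_2_eq_2)
  have dbl: "[(2::nat)] \<cdot>\<^bsub>A\<^esub> e = e \<oplus>\<^bsub>A\<^esub> e" if "e \<in> carrier A" for e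
    using that by (simp add: numeral_2_eq_2)
  let ?add = "\<lambda>x y. (x \<oplus>\<^bsub>A\<^esub> y) \<ominus>\<^bsub>A\<^esub> (x \<otimes>\<^bsub>A\<^esub> y \<oplus>\<^bsub>A\<^esub> x \<otimes>\<^bsub>A\<^esub> y)"
  have lc: "x \<otimes>\<^bsub>A\<^esub> (x \<otimes>\<^bsub>A\<^esub> y) = x \<otimes>\<^bsub>A\<^esub> y"
    if "x \<in> carrier A" "y \<in> carrier A" "x \<otimes>\<^bsub>A\<^esub> x = x" for x y
    using that by (metis m_assoc)
  have closed: "?add x y \<otimes>\<^bsub>A\<^esub> ?add x y = ?add x y"
    if xy: "x \<in> carrier A" "y \<in> carrier A" "x \<otimes>\<^bsub>A\<^esub> x = x" "y \<otimes>\<^bsub>A\<^esub> y = y" for x y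
  proof -
    have y': "y \<otimes>\<^bsub>A\<^esub> (x \<otimes>\<^bsub>A\<^esub> y) = x \<otimes>\<^bsub>A\<^esub> y"
      using xy by (metis m_assoc m_comm)
    show ?thesis using xy lc[OF xy(1,2,3)] y'
      by (simp add: a_minus_def l_distr r_distr l_minus r_minus m_ac minus_add a_ac r_neg r_neg1 r_neg2)
  qed
  have r: "carrier (idem_ring A) = {e \<in> carrier A. e \<otimes>\<^bsub>A\<^esub> e = e}"
    "monoid.mult (idem_ring A) = monoid.mult A" "monoid.one (idem_ring A) = monoid.one A" "ring.zero (idem_ring A) = ring.zero A"
    by (auto simp: idem_ring_def pow2)
  have a: "ring.add (idem_ring A) x y = ?add x y" if "x \<in> carrier A" "y \<in> carrier A" for x y
    using that by (simp add: idem_ring_def dbl)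
  show ?thesis
  proof (intro cringI abelian_groupI comm_monoidI)
    fix x assume "x \<in> carrier (idem_ring A)"
    then show "\<exists>y\<in>carrier (idem_ring A). y \<oplus>\<^bsub>idem_ring A\<^esub> x = \<zero>\<^bsub>idem_ring A\<^esub>"
      by (intro bexI[of _ x]) (auto simp: r a a_minus_def r_neg)
  next
    fix x y assume "x \<in> carrier (idem_ring A)" "y \<in> carrier (idem_ring A)"
    then show "x \<oplus>\<^bsub>idem_ring A\<^esub> y \<in> carrier (idem_ring A)"
      by (auto simp: r a closed)
    show "x \<otimes>\<^bsub>idem_ring A\<^esub> y \<in> carrier (idem_ring A)"
      using \<open>x \<in> _\<close> \<open>y \<in> _\<close> lc by (auto simp: r m_ac)
    show "x \<oplus>\<^bsub>idem_ring A\<^esub> y = y \<oplus>\<^bsub>idem_ring A\<^esub> x"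
      using \<open>x \<in> _\<close> \<open>y \<in> _\<close> by (auto simp: r a m_comm a_comm)
  next
    fix x y z
    assume xyz: "x \<in> carrier (idem_ring A)" "y \<in> carrier (idem_ring A)" "z \<in> carrier (idem_ring A)"
    show "(x \<oplus>\<^bsub>idem_ring A\<^esub> y) \<oplus>\<^bsub>idem_ring A\<^esub> z = x \<oplus>\<^bsub>idem_ring A\<^esub> (y \<oplus>\<^bsub>idem_ring A\<^esub> z)"
      using xyz by (simp add: r a a_minus_def l_distr r_distr l_minus r_minus minus_add m_ac a_ac)
    show "(x \<oplus>\<^bsub>idem_ring A\<^esub> y) \<otimes>\<^bsub>idem_ring A\<^esub> z =
        x \<otimes>\<^bsub>idem_ring A\<^esub> z \<oplus>\<^bsub>idem_ring A\<^esub> y \<otimes>\<^bsub>idem_ring A\<^esub> z"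
    proof -
      have "(x \<otimes>\<^bsub>A\<^esub> z) \<otimes>\<^bsub>A\<^esub> (y \<otimes>\<^bsub>A\<^esub> z) = (x \<otimes>\<^bsub>A\<^esub> y) \<otimes>\<^bsub>A\<^esub> z"
      proof -
        have "(x \<otimes>\<^bsub>A\<^esub> z) \<otimes>\<^bsub>A\<^esub> (y \<otimes>\<^bsub>A\<^esub> z) = (x \<otimes>\<^bsub>A\<^esub> y) \<otimes>\<^bsub>A\<^esub> (z \<otimes>\<^bsub>A\<^esub> z)"
          using xyz by (simp add: r m_ac)
        then show ?thesis using xyz by (simp add: r)
      qed
      then show ?thesis
        using xyz by (simp add: r a a_minus_def l_distr l_minus)
    qed
  qed (auto simp: r a a_minus_def m_ac)
qed

definition powerset_ring :: "'a set \<Rightarrow> 'a set ring"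
  where "powerset_ring X =
    \<lparr>carrier = Pow X, monoid.mult = (\<inter>), monoid.one = X, ring.zero = {}, ring.add = sym_diff\<rparr>"

definition clop_ring :: "'a topology \<Rightarrow> 'a set ring"
  where "clop_ring T =
    powerset_ring (topspace T)\<lparr>carrier := {U. openin T U \<and> closedin T U}\<rparr>"

lemma cring_powerset_ring: "cring (powerset_ring X)"
proof (intro cringI abelian_groupI comm_monoidI)
  fix x assume "x \<in> carrier (powerset_ring X)"
  then show "\<exists>y\<in>carrier (powerset_ring X). y \<oplus>\<^bsub>powerset_ring X\<^esub> x = \<zero>\<^bsub>powerset_ring X\<^esub>"
    by (intro bexI[of _ x]) (auto simp: powerset_ring_def)
qed (auto simp: powerset_ring_def)

lemma subcring_clop:
  "subcring {U. openin T U \<and> closedin T U} (powerset_ring (topspace T))"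
proof -
  interpret cring "powerset_ring (topspace T)" by (rule cring_powerset_ring)
  have sub: "{U. openin T U \<and> closedin T U} \<subseteq> carrier (powerset_ring (topspace T))"
    by (auto simp: powerset_ring_def dest: openin_subset)
  have neg: "\<ominus>\<^bsub>powerset_ring (topspace T)\<^esub> U = U" if "U \<subseteq> topspace T" for U
    using minus_equality[of U U] that by (simp add: powerset_ring_def)
  have "subring {U. openin T U \<and> closedin T U} (powerset_ring (topspace T))"
  proof (rule subringI[OF sub])
    fix U V
    assume "U \<in> {U. openin T U \<and> closedin T U}" "V \<in> {U. openin T U \<and> closedin T U}"
    then show "U \<oplus>\<^bsub>powerset_ring (topspace T)\<^esub> V \<in> {U. openin T U \<and> closedin T U}"
      by (auto simp: powerset_ring_def intro: openin_diff closedin_diff)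
    show "U \<otimes>\<^bsub>powerset_ring (topspace T)\<^esub> V \<in> {U. openin T U \<and> closedin T U}"
      using \<open>U \<in> _\<close> \<open>V \<in> _\<close> by (auto simp: powerset_ring_def)
  next
    show "\<one>\<^bsub>powerset_ring (topspace T)\<^esub> \<in> {U. openin T U \<and> closedin T U}"
      by (simp add: powerset_ring_def)
  qed (simp add: neg openin_subset)
  then show ?thesis
    by (rule subcringI')
qed

lemma cring_clop_ring: "cring (clop_ring T)"
proof -
  interpret cring "powerset_ring (topspace T)" by (rule cring_powerset_ring)
  have "{U. openin T U \<and> closedin T U} \<subseteq> carrier (powerset_ring (topspace T))"
    by (auto simp: powerset_ring_def dest: openin_subset)
  then show ?thesis
    using subcring_iff subcring_clop unfolding clop_ring_def by blast
qed

end

theory Submission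
  imports Defs "HOL-Algebra.Ring_Divisibility"
begin

text \<open>
  A coset \<open>f + J\<close> is sent to the set of maximal ideals that do not contain it. Modulo a maximal
  ideal \<open>m\<close> an element that is idempotent modulo \<open>J\<close> is congruent to \<open>0\<close> or \<open>1\<close>, so its class
  modulo \<open>J\<close> is determined by the \<open>m\<close> that contain it; this gives the homomorphism property and
  injectivity. For surjectivity, write a clopen set and its complement as the complements of
  \<open>V(E)\<close> and \<open>V(F)\<close> in \<open>Max(R)\<close>. No maximal ideal contains both \<open>E\<close> and \<open>F\<close>, so \<open>1 = e + f\<close> with
  \<open>e\<close> in the ideal of \<open>E\<close> and \<open>f\<close> in that of \<open>F\<close>. Every maximal ideal contains \<open>E\<close> or \<open>F\<close>, so
  \<open>e (1 - e) = e f\<close> lies in \<open>J\<close>, and \<open>D(e)\<close> cuts out the given clopen set.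
\<close>

section \<open>Existence of maximal ideals and comaximality\<close>

text \<open>Zorn's lemma for the ideals above \<open>I\<close> that avoid 1. An ideal containing 1
  is the whole carrier, so an ideal maximal among those avoiding 1 is a maximal ideal.\<close>

lemma (in cring) ideal_subset_maximalideal:
  assumes "ideal I R" "\<one> \<notin> I"
  shows "\<exists>m. maximalideal m R \<and> I \<subseteq> m"
proof -
  let ?S = "{K. ideal K R \<and> I \<subseteq> K \<and> \<one> \<notin> K}"
  have "\<exists>m\<in>?S. \<forall>K\<in>?S. m \<subseteq> K \<longrightarrow> K = m"
  proof (rule subset_Zorn_nonempty)
    show "?S \<noteq> {}" using assms by blast
    fix C assume C: "C \<noteq> {}" "subset.chain ?S C"
    then have "subset.chain {K. ideal K R} C"
      by (auto simp: pred_on.chain_def)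
    \<comment> \<open>For the empty chain \<open>chain_Union_is_ideal\<close> yields the zero ideal
      instead of the union; nonemptiness of \<open>C\<close> selects the union.\<close>
    then have "ideal (\<Union>C) R"
      using chain_Union_is_ideal[of C] C(1) by simp
    moreover have "C \<subseteq> ?S" using C(2) by (simp add: pred_on.chain_def)
    ultimately show "\<Union>C \<in> ?S" using C(1) by blast
  qed
  then obtain m where m: "ideal m R" "I \<subseteq> m" "\<one> \<notin> m"
    and "\<forall>K\<in>?S. m \<subseteq> K \<longrightarrow> K = m" by auto
  then have max: "K = m" if "ideal K R" "I \<subseteq> K" "\<one> \<notin> K" "m \<subseteq> K" for K
    using that by simp
  have "maximalideal m R"
  proof (rule maximalidealI[OF m(1)])
    show "carrier R \<noteq> m" using m(3) one_closed by metis
    show "K = m \<or> K = carrier R" if "ideal K R" "m \<subseteq> K" "K \<subseteq> carrier R" for K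
    proof (cases "\<one> \<in> K")
      case True
      then show ?thesis using ideal.one_imp_carrier[OF that(1)] by simp
    next
      case False
      then show ?thesis using max[of K] m(2) that by simp
    qed
  qed
  with m(2) show ?thesis by blast
qed

text \<open>If 1 were not in the sum of \<open>I\<close> and \<open>K\<close>, a maximal ideal would
  contain that sum. Since 0 lies in both ideals, the sum contains each of them, which the third
  assumption excludes.\<close>

lemma (in cring) comaximal_ideals:
  assumes "ideal I R" "ideal K R" "\<And>m. maximalideal m R \<Longrightarrow> \<not> (I \<subseteq> m \<and> K \<subseteq> m)"
  obtains a b where "a \<in> I" "b \<in> K" "a \<oplus> b = \<one>"
proof -
  have zero: "\<zero> \<in> I" "\<zero> \<in> K"
    using assms(1,2) by (simp_all add: additive_subgroup.zero_closed ideal.axioms(1))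
  have mem: "x \<oplus> y \<in> I <+>\<^bsub>R\<^esub> K" if "x \<in> I" "y \<in> K" for x y
    using that unfolding set_add_def' by blast
  have "x \<in> I <+>\<^bsub>R\<^esub> K" if "x \<in> I" for x
    using mem[OF that zero(2)] ideal.Icarr[OF assms(1) that] by simp
  moreover have "x \<in> I <+>\<^bsub>R\<^esub> K" if "x \<in> K" for x
    using mem[OF zero(1) that] ideal.Icarr[OF assms(2) that] by simp
  ultimately have "\<one> \<in> I <+>\<^bsub>R\<^esub> K"
    using ideal_subset_maximalideal[OF add_ideals[OF assms(1,2)]] assms(3) by blast
  then show thesis using that unfolding set_add_def' by auto
qed

section \<open>Elements idempotent modulo a prime ideal\<close>

lemma (in ideal) add_mem_iff:
  assumes "x \<in> I" "y \<in> carrier R"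
  shows "x \<oplus> y \<in> I \<longleftrightarrow> y \<in> I" "y \<oplus> x \<in> I \<longleftrightarrow> y \<in> I"
proof -
  have "y \<in> I" if "x \<oplus> y \<in> I"
  proof -
    have "\<ominus> x \<oplus> (x \<oplus> y) \<in> I"
      by (rule additive_subgroup.a_closed[OF is_additive_subgroup
            additive_subgroup.a_inv_closed[OF is_additive_subgroup assms(1)] that])
    then show ?thesis by (simp only: r_neg1[OF Icarr[OF assms(1)] assms(2)])
  qed
  moreover have "x \<oplus> y \<in> I" if "y \<in> I"
    using assms(1) that by (rule additive_subgroup.a_closed[OF is_additive_subgroup])
  ultimately show *: "x \<oplus> y \<in> I \<longleftrightarrow> y \<in> I" by (rule iffI)
  show "y \<oplus> x \<in> I \<longleftrightarrow> y \<in> I"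
    using * by (simp only: a_comm[OF Icarr[OF assms(1)] assms(2)])
qed

lemma (in primeideal) mult_mem_iff:
  assumes "x \<in> carrier R" "y \<in> carrier R"
  shows "x \<otimes> y \<in> I \<longleftrightarrow> x \<in> I \<or> y \<in> I"
  using assms I_prime I_l_closed I_r_closed by blast

lemma (in primeideal) one_notin: "\<one> \<notin> I"
  using one_imp_carrier I_notcarr by blast

text \<open>The elements \<open>f\<close> and \<open>\<one> \<ominus> f\<close> sum to 1, so
  \<open>I\<close> contains at most one of them; their product lies in the prime \<open>I\<close>,
  so it contains at least one.\<close>

lemma (in primeideal) one_minus_mem_iff:
  assumes f: "f \<in> carrier R" and idem: "f \<otimes> (\<one> \<ominus> f) \<in> I"
  shows "\<one> \<ominus> f \<in> I \<longleftrightarrow> f \<notin> I"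
proof -
  have "f \<oplus> (\<one> \<ominus> f) = \<one>" using f by algebra
  then have "\<not> (f \<in> I \<and> \<one> \<ominus> f \<in> I)"
    using one_notin additive_subgroup.a_closed[OF is_additive_subgroup] by metis
  moreover have "f \<in> I \<or> \<one> \<ominus> f \<in> I"
    using mult_mem_iff[of f "\<one> \<ominus> f"] f idem by simp
  ultimately show ?thesis by blast
qed

text \<open>The Boolean sum equals f(1 - g) + g(1 - f). One summand always lies in \<open>I\<close>,
  the first if \<open>f\<close> does and the second otherwise, so the other summand decides. This is
  what turns Boolean addition into symmetric difference.\<close>

lemma (in primeideal) sym_diff_mem_iff:
  assumes f: "f \<in> carrier R" "f \<otimes> (\<one> \<ominus> f) \<in> I"
    and g: "g \<in> carrier R" "g \<otimes> (\<one> \<ominus> g) \<in> I"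
  shows "(f \<oplus> g) \<ominus> [(2::nat)] \<cdot> (f \<otimes> g) \<in> I \<longleftrightarrow> (f \<in> I \<longleftrightarrow> g \<in> I)"
proof -
  have "(f \<oplus> g) \<ominus> [(2::nat)] \<cdot> (f \<otimes> g) = (f \<oplus> g) \<ominus> (f \<otimes> g \<oplus> f \<otimes> g)"
    using f g by (simp add: numeral_2_eq_2)
  also have "\<dots> = f \<otimes> (\<one> \<ominus> g) \<oplus> g \<otimes> (\<one> \<ominus> f)"
    using f g by algebra
  finally have eq: "(f \<oplus> g) \<ominus> [(2::nat)] \<cdot> (f \<otimes> g) = f \<otimes> (\<one> \<ominus> g) \<oplus> g \<otimes> (\<one> \<ominus> f)" .
  have compl: "\<one> \<ominus> f \<in> I \<longleftrightarrow> f \<notin> I" "\<one> \<ominus> g \<in> I \<longleftrightarrow> g \<notin> I"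
    by (rule one_minus_mem_iff[OF f], rule one_minus_mem_iff[OF g])
  show ?thesis
  proof (cases "f \<in> I")
    case True
    then have "f \<otimes> (\<one> \<ominus> g) \<in> I" using f g compl by (simp add: mult_mem_iff)
    then show ?thesis unfolding eq
      using f g True compl by (simp add: add_mem_iff(1) mult_mem_iff)
  next
    case False
    then have "g \<otimes> (\<one> \<ominus> f) \<in> I" using f g compl by (simp add: mult_mem_iff)
    then show ?thesis unfolding eq
      using f g False compl by (simp add: add_mem_iff(2) mult_mem_iff)
  qed
qed

text \<open>Both elements are congruent to 0 modulo \<open>I\<close> or both to 1. In the second
  case f - g = (1 - g) - (1 - f) is a difference of elements of \<open>I\<close>.\<close>

lemma (in primeideal) minus_mem_if_idem:
  assumes f: "f \<in> carrier R" "f \<otimes> (\<one> \<ominus> f) \<in> I"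
    and g: "g \<in> carrier R" "g \<otimes> (\<one> \<ominus> g) \<in> I"
    and eq: "f \<in> I \<longleftrightarrow> g \<in> I"
  shows "f \<ominus> g \<in> I"
proof (cases "f \<in> I")
  case True
  then show ?thesis
    using eq additive_subgroup.a_closed[OF is_additive_subgroup] unfolding a_minus_def by simp
next
  case False
  then have "\<one> \<ominus> f \<in> I" "\<one> \<ominus> g \<in> I"
    using one_minus_mem_iff[OF f] one_minus_mem_iff[OF g] eq by blast+
  then have "(\<one> \<ominus> g) \<oplus> \<ominus> (\<one> \<ominus> f) \<in> I"
    using additive_subgroup.a_closed[OF is_additive_subgroup] by simp
  moreover have "(\<one> \<ominus> g) \<oplus> \<ominus> (\<one> \<ominus> f) = f \<ominus> g"
    using f(1) g(1) by algebra
  ultimately show ?thesis by simp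
qed

lemma (in cring) Maxspec_primeideal: "m \<in> Maxspec R \<Longrightarrow> primeideal m R"
  by (simp add: Maxspec_def maximalideal_prime)

section \<open>Cosets and idempotents of a quotient\<close>

text \<open>Inclusion of a coset in \<open>K\<close> mentions no representative, so this allows a
  map on cosets to be defined without choosing one.\<close>

lemma (in ideal) coset_subset_iff:
  assumes "ideal K R" "I \<subseteq> K" "f \<in> carrier R"
  shows "I +> f \<subseteq> K \<longleftrightarrow> f \<in> K"
proof -
  interpret K: ideal K R by (rule assms(1))
  show ?thesis
  proof
    show "I +> f \<subseteq> K \<Longrightarrow> f \<in> K" using a_rcos_self assms(3) by blast
    show "f \<in> K \<Longrightarrow> I +> f \<subseteq> K" using assms(2) by (auto simp: a_r_coset_def')
  qed
qed

text \<open>The cosets of \<open>f\<close> and its square agree exactly when their difference, which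
  is f(1 - f), lies in \<open>I\<close>.\<close>

lemma (in cring) coset_in_idem_ring_Quot_iff:
  assumes "ideal I R" "f \<in> carrier R"
  shows "I +> f \<in> carrier (idem_ring (R Quot I)) \<longleftrightarrow> f \<otimes> (\<one> \<ominus> f) \<in> I"
proof -
  interpret I: ideal I R by (rule assms(1))
  interpret h: ring_hom_ring R "R Quot I" "(+>) I" by (rule I.rcos_ring_hom_ring)
  have "(I +> f) [^]\<^bsub>R Quot I\<^esub> (2::nat) = I +> f \<otimes> f"
    using assms(2) by (simp add: numeral_2_eq_2)
  moreover have "f \<ominus> f \<otimes> f = f \<otimes> (\<one> \<ominus> f)" using assms(2) by algebra
  ultimately show ?thesis
    using assms(2) quotient_eq_iff_same_a_r_cos[OF assms(1,2), of "f \<otimes> f"]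
    by (simp add: idem_ring_def)
qed

section \<open>Clopen subsets of the maximal spectrum\<close>

lemma openin_Max_top:
  assumes "cring R"
  shows "openin (Max_top R) U \<longleftrightarrow> (\<exists>E\<subseteq>carrier R. U = {m \<in> Maxspec R. \<not> E \<subseteq> m})"
proof -
  have sub: "Maxspec R \<subseteq> Spec R"
    using cring.Maxspec_primeideal[OF assms] by (auto simp: Spec_def)
  have eq: "(Spec R - {p \<in> Spec R. E \<subseteq> p}) \<inter> Maxspec R = {m \<in> Maxspec R. \<not> E \<subseteq> m}" for E
    using sub by blast
  show ?thesis
    unfolding Max_top_def openin_subtopology openin_zariski by (auto simp: eq[symmetric])
qed

text \<open>Each maximal ideal contains exactly one of \<open>f\<close> and
  \<open>\<one> \<ominus> f\<close>, so the complement of the set given by \<open>f\<close> is the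
  set given by \<open>\<one> \<ominus> f\<close>, which is open as well.\<close>

lemma (in cring) clopen_Max_top_D:
  assumes f: "f \<in> carrier R" "f \<otimes> (\<one> \<ominus> f) \<in> jacobson_radical R"
  shows "openin (Max_top R) {m \<in> Maxspec R. f \<notin> m}"
    and "closedin (Max_top R) {m \<in> Maxspec R. f \<notin> m}"
proof -
  have op: "openin (Max_top R) {m \<in> Maxspec R. g \<notin> m}" if "g \<in> carrier R" for g
    unfolding openin_Max_top[OF is_cring] using that by (intro exI[of _ "{g}"]) auto
  show "openin (Max_top R) {m \<in> Maxspec R. f \<notin> m}" by (rule op[OF f(1)])
  have "\<one> \<ominus> f \<notin> m \<longleftrightarrow> f \<in> m" if "m \<in> Maxspec R" for m
    using primeideal.one_minus_mem_iff[OF Maxspec_primeideal[OF that] f(1)] f(2) that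
    by (auto simp: jacobson_radical_def)
  then have "Maxspec R - {m \<in> Maxspec R. f \<notin> m} = {m \<in> Maxspec R. \<one> \<ominus> f \<notin> m}" by blast
  with op[of "\<one> \<ominus> f"] f(1) show "closedin (Max_top R) {m \<in> Maxspec R. f \<notin> m}"
    by (auto simp: closedin_def topspace_Max_top[OF is_cring])
qed

lemma (in cring) clopen_Max_top_E:
  assumes "openin (Max_top R) U" "closedin (Max_top R) U"
  obtains f where "f \<in> carrier R" "f \<otimes> (\<one> \<ominus> f) \<in> jacobson_radical R"
    "U = {m \<in> Maxspec R. f \<notin> m}"
proof -
  obtain E where E: "E \<subseteq> carrier R" "U = {m \<in> Maxspec R. \<not> E \<subseteq> m}"
    using assms(1) openin_Max_top[OF is_cring] by blast
  obtain F where F: "F \<subseteq> carrier R" "Maxspec R - U = {m \<in> Maxspec R. \<not> F \<subseteq> m}"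
    using assms(2) openin_Max_top[OF is_cring] topspace_Max_top[OF is_cring]
    unfolding closedin_def by metis
  \<comment> \<open>A maximal ideal lies in exactly one of \<open>U\<close> and its
    complement.\<close>
  have one: "E \<subseteq> m \<longleftrightarrow> \<not> F \<subseteq> m" if "m \<in> Maxspec R" for m
    using E(2) F(2) that by blast
  have max_ideal: "ideal m R" if "m \<in> Maxspec R" for m
    using that by (simp add: Maxspec_def maximalideal.axioms(1))
  have "\<not> (Idl E \<subseteq> m \<and> Idl F \<subseteq> m)" if "maximalideal m R" for m
    using one[of m] that genideal_self[OF E(1)] genideal_self[OF F(1)]
    by (auto simp: Maxspec_def)
  from comaximal_ideals[OF genideal_ideal[OF E(1)] genideal_ideal[OF F(1)] this]
  obtain e f where ef: "e \<in> Idl E" "f \<in> Idl F" "e \<oplus> f = \<one>" by blast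
  have c: "e \<in> carrier R" "f \<in> carrier R"
    using ef(1,2) ideal.Icarr[OF genideal_ideal[OF E(1)]] ideal.Icarr[OF genideal_ideal[OF F(1)]]
    by auto
  have "\<one> \<ominus> e = f"
  proof -
    have "(e \<oplus> f) \<ominus> e = f" using c by algebra
    then show ?thesis using ef(3) by simp
  qed
  then have "e \<otimes> (\<one> \<ominus> e) = e \<otimes> f" by simp
  \<comment> \<open>Containing \<open>E\<close> forces \<open>e\<close> into \<open>m\<close>, and
    containing \<open>F\<close> forces \<open>f\<close> into \<open>m\<close>. Exactly one of these
    inclusions holds, and \<open>m\<close> cannot contain both summands of 1, so \<open>e\<close>
    lies in \<open>m\<close> only if \<open>E\<close> does.\<close>
  moreover have e_iff: "e \<notin> m \<longleftrightarrow> \<not> E \<subseteq> m" and "e \<otimes> f \<in> m" if m: "m \<in> Maxspec R" for m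
  proof -
    interpret primeideal m R by (rule Maxspec_primeideal[OF m])
    have "E \<subseteq> m \<Longrightarrow> e \<in> m" "F \<subseteq> m \<Longrightarrow> f \<in> m"
      using genideal_minimal[OF max_ideal[OF m]] ef(1,2) by blast+
    moreover have "\<not> (e \<in> m \<and> f \<in> m)"
      using ef(3) one_notin additive_subgroup.a_closed[OF is_additive_subgroup] by metis
    ultimately show "e \<notin> m \<longleftrightarrow> \<not> E \<subseteq> m" "e \<otimes> f \<in> m"
      using one[OF m] c by (auto simp: mult_mem_iff)
  qed
  ultimately have "e \<otimes> (\<one> \<ominus> e) \<in> jacobson_radical R"
    using c by (auto simp: jacobson_radical_def)
  moreover have "U = {m \<in> Maxspec R. e \<notin> m}" using E(2) e_iff by blast
  ultimately show thesis using that c(1) by blast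
qed

section \<open>The isomorphism\<close>

text \<open>The formula for the map is asserted for every representative of every idempotent coset,
  so independence of the representative is part of the claim.\<close>

theorem corollary3p16:
  fixes R :: "('a, 'b) ring_scheme"
  defines "J \<equiv> jacobson_radical R"
    and "X \<equiv> Maxspec R"
  assumes "cring R"
  shows "\<exists>\<phi>. (\<forall>f\<in>carrier R. J +>\<^bsub>R\<^esub> f \<in> carrier (idem_ring (R Quot J)) \<longrightarrow>
                  \<phi> (J +>\<^bsub>R\<^esub> f) = X \<inter> basic_open R f)
           \<and> \<phi> \<in> ring_iso (idem_ring (R Quot J)) (clop_ring (Max_top R))"
proof -
  interpret cring R by (rule assms(3))
  interpret J: ideal J R unfolding J_def by (rule ideal_jacobson_radical[OF assms(3)])
  interpret h: ring_hom_ring R "R Quot J" "(+>\<^bsub>R\<^esub>) J" by (rule J.rcos_ring_hom_ring)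
  let ?B = "idem_ring (R Quot J)" and ?C = "clop_ring (Max_top R)"
  define \<phi> where "\<phi> c = {m \<in> X. \<not> c \<subseteq> m}" for c
  have prime: "primeideal m R" if "m \<in> X" for m
    using that Maxspec_primeideal by (simp add: X_def)
  have J_le: "J \<subseteq> m" if "m \<in> X" for m
    using that by (auto simp: J_def X_def jacobson_radical_def)
  have \<phi>: "\<phi> (J +>\<^bsub>R\<^esub> f) = {m \<in> X. f \<notin> m}" if "f \<in> carrier R" for f
    using that J.coset_subset_iff[OF primeideal.axioms(1)[OF prime] J_le]
    unfolding \<phi>_def by blast
  \<comment> \<open>Provides the representatives with f(1 - f) in \<open>J\<close> on which the
    homomorphism and injectivity arguments compute.\<close>
  have B: "\<exists>f\<in>carrier R. x = J +>\<^bsub>R\<^esub> f \<and> f \<otimes>\<^bsub>R\<^esub> (\<one>\<^bsub>R\<^esub> \<ominus>\<^bsub>R\<^esub> f) \<in> J" if x: "x \<in> carrier ?B" for x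
  proof -
    have "carrier ?B = {e \<in> a_rcosets\<^bsub>R\<^esub> J. e = e [^]\<^bsub>R Quot J\<^esub> (2::nat)}"
      by (simp only: idem_ring_def FactRing_def partial_object.simps)
    then have "x \<in> a_rcosets\<^bsub>R\<^esub> J" using x by blast
    then obtain f where "f \<in> carrier R" "x = J +>\<^bsub>R\<^esub> f" unfolding A_RCOSETS_def' by blast
    then show ?thesis using x coset_in_idem_ring_Quot_iff[OF J.ideal_axioms] by blast
  qed
  have C: "carrier ?C = {U. openin (Max_top R) U \<and> closedin (Max_top R) U}"
    "monoid.mult ?C = (\<inter>)" "ring.add ?C = sym_diff" "monoid.one ?C = X"
    by (auto simp: clop_ring_def powerset_ring_def topspace_Max_top[OF assms(3)] X_def)
  have D: "{m \<in> X. f \<notin> m} \<in> carrier ?C"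
    if "f \<in> carrier R" "f \<otimes>\<^bsub>R\<^esub> (\<one>\<^bsub>R\<^esub> \<ominus>\<^bsub>R\<^esub> f) \<in> J" for f
    using clopen_Max_top_D[OF that(1) that(2)[unfolded J_def]] by (simp add: C(1) X_def)
  have closed: "\<phi> x \<in> carrier ?C" if x: "x \<in> carrier ?B" for x
  proof -
    obtain f where "f \<in> carrier R" "x = J +>\<^bsub>R\<^esub> f" "f \<otimes>\<^bsub>R\<^esub> (\<one>\<^bsub>R\<^esub> \<ominus>\<^bsub>R\<^esub> f) \<in> J"
      using B[OF x] by blast
    then show ?thesis using D[of f] by (simp only: \<phi>)
  qed
  have "\<phi> \<in> ring_iso ?B ?C"
  proof (rule ring_iso_memI)
    show "\<And>x. x \<in> carrier ?B \<Longrightarrow> \<phi> x \<in> carrier ?C" by (rule closed)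
  next
    fix x y assume "x \<in> carrier ?B" "y \<in> carrier ?B"
    then obtain f g where f: "f \<in> carrier R" "x = J +>\<^bsub>R\<^esub> f" "f \<otimes>\<^bsub>R\<^esub> (\<one>\<^bsub>R\<^esub> \<ominus>\<^bsub>R\<^esub> f) \<in> J"
      and g: "g \<in> carrier R" "y = J +>\<^bsub>R\<^esub> g" "g \<otimes>\<^bsub>R\<^esub> (\<one>\<^bsub>R\<^esub> \<ominus>\<^bsub>R\<^esub> g) \<in> J"
      using B by meson
    let ?s = "(f \<oplus>\<^bsub>R\<^esub> g) \<ominus>\<^bsub>R\<^esub> [(2::nat)] \<cdot>\<^bsub>R\<^esub> (f \<otimes>\<^bsub>R\<^esub> g)"
    have \<phi>_xy: "\<phi> x = {m \<in> X. f \<notin> m}" "\<phi> y = {m \<in> X. g \<notin> m}"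
      using \<phi>[OF f(1)] \<phi>[OF g(1)] by (simp_all only: f(2) g(2))
    have "x \<otimes>\<^bsub>?B\<^esub> y = J +>\<^bsub>R\<^esub> (f \<otimes>\<^bsub>R\<^esub> g)"
      using f(1,2) g(1,2) by (simp add: idem_ring_def)
    then have "\<phi> (x \<otimes>\<^bsub>?B\<^esub> y) = {m \<in> X. f \<otimes>\<^bsub>R\<^esub> g \<notin> m}"
      using \<phi>[of "f \<otimes>\<^bsub>R\<^esub> g"] f(1) g(1) by (simp only: m_closed)
    then show "\<phi> (x \<otimes>\<^bsub>?B\<^esub> y) = \<phi> x \<otimes>\<^bsub>?C\<^esub> \<phi> y"
      using primeideal.mult_mem_iff[OF prime f(1) g(1)] by (auto simp: \<phi>_xy C)
    have "x \<oplus>\<^bsub>?B\<^esub> y = J +>\<^bsub>R\<^esub> ?s"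
      using f(1,2) g(1,2) by (simp add: idem_ring_def a_minus_def numeral_2_eq_2)
    moreover have "?s \<in> carrier R" using f(1) g(1) by simp
    ultimately have "\<phi> (x \<oplus>\<^bsub>?B\<^esub> y) = {m \<in> X. ?s \<notin> m}"
      by (simp only: \<phi>)
    \<comment> \<open>Avoiding \<open>?s\<close> thus means avoiding exactly one of \<open>f\<close>
      and \<open>g\<close>, that is, lying in the symmetric difference of \<open>\<phi> x\<close>
      and \<open>\<phi> y\<close>.\<close>
    moreover have "?s \<in> m \<longleftrightarrow> (f \<in> m \<longleftrightarrow> g \<in> m)" if "m \<in> X" for m
      using primeideal.sym_diff_mem_iff[OF prime[OF that] f(1) _ g(1)] f(3) g(3) J_le[OF that]
      by blast
    ultimately show "\<phi> (x \<oplus>\<^bsub>?B\<^esub> y) = \<phi> x \<oplus>\<^bsub>?C\<^esub> \<phi> y"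
      by (auto simp: \<phi>_xy C)
  next
    have "\<one>\<^bsub>?B\<^esub> = J +>\<^bsub>R\<^esub> \<one>\<^bsub>R\<^esub>" by (simp add: idem_ring_def)
    then have "\<phi> \<one>\<^bsub>?B\<^esub> = {m \<in> X. \<one>\<^bsub>R\<^esub> \<notin> m}" by (simp only: \<phi> one_closed)
    then show "\<phi> \<one>\<^bsub>?B\<^esub> = \<one>\<^bsub>?C\<^esub>"
      using primeideal.one_notin[OF prime] by (auto simp: C)
  next
    show "bij_betw \<phi> (carrier ?B) (carrier ?C)"
    proof (rule bij_betw_imageI)
      show "inj_on \<phi> (carrier ?B)"
      proof (rule inj_onI)
        fix x y assume "x \<in> carrier ?B" "y \<in> carrier ?B" and eq: "\<phi> x = \<phi> y"
        then obtain f g where f: "f \<in> carrier R" "x = J +>\<^bsub>R\<^esub> f" "f \<otimes>\<^bsub>R\<^esub> (\<one>\<^bsub>R\<^esub> \<ominus>\<^bsub>R\<^esub> f) \<in> J"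
          and g: "g \<in> carrier R" "y = J +>\<^bsub>R\<^esub> g" "g \<otimes>\<^bsub>R\<^esub> (\<one>\<^bsub>R\<^esub> \<ominus>\<^bsub>R\<^esub> g) \<in> J"
          using B by meson
        have "f \<ominus>\<^bsub>R\<^esub> g \<in> m" if "m \<in> X" for m
          using primeideal.minus_mem_if_idem[OF prime[OF that] f(1) _ g(1)] f g J_le[OF that]
            eq that by (auto simp: \<phi>)
        \<comment> \<open>Membership in the carrier covers the zero ring, where \<open>X\<close> is
          empty and \<open>J\<close> is the carrier.\<close>
        then have "f \<ominus>\<^bsub>R\<^esub> g \<in> J"
          using f(1) g(1) by (auto simp: J_def X_def jacobson_radical_def)
        then show "x = y"
          using f g quotient_eq_iff_same_a_r_cos[OF J.ideal_axioms] by simp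
      qed
      show "\<phi> ` carrier ?B = carrier ?C"
      proof
        show "\<phi> ` carrier ?B \<subseteq> carrier ?C"
          using closed by blast
        show "carrier ?C \<subseteq> \<phi> ` carrier ?B"
        proof
          fix U assume "U \<in> carrier ?C"
          then have "openin (Max_top R) U" "closedin (Max_top R) U" by (simp_all add: C(1))
          then obtain f where f: "f \<in> carrier R" "f \<otimes>\<^bsub>R\<^esub> (\<one>\<^bsub>R\<^esub> \<ominus>\<^bsub>R\<^esub> f) \<in> J" "U = {m \<in> X. f \<notin> m}"
            unfolding J_def X_def by (rule clopen_Max_top_E)
          then have "J +>\<^bsub>R\<^esub> f \<in> carrier ?B"
            by (simp add: coset_in_idem_ring_Quot_iff[OF J.ideal_axioms])
          moreover have "U = \<phi> (J +>\<^bsub>R\<^esub> f)" using f by (simp only: \<phi>)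
          ultimately show "U \<in> \<phi> ` carrier ?B" by (rule rev_image_eqI)
        qed
      qed
    qed
  qed
  moreover have "\<phi> (J +>\<^bsub>R\<^esub> f) = X \<inter> basic_open R f" if "f \<in> carrier R" for f
    using that prime by (auto simp: \<phi> basic_open_def Spec_def)
  ultimately show ?thesis by blast
qed

end
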